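(* Let $(X,d)$ be a proper Polish metric space, let $p\in[1,\infty)$, let $r>0$, and let $\nu\in\mathcal{P}(X)$ have a finite $p$-th moment. Then the Wasserstein ball $\mathcal{B}_r(\nu)=\{\mu\in\mathcal{P}(X): W_p(\mu,\nu)\le r\}$ is weakly compact.
   Context: A Polish metric space is a complete and separable metric space. $(X,d)$ is proper if every closed ball $B_R(x_0)=\{x\in X: d(x,x_0)\le R\}$, with $R>0$ and $x_0\in X$, is compact. $\mathcal{P}(X)$ is the set of all Borel probability measures on $X$. For $\mu_1,\mu_2\in\mathcal{P}(X)$, $$W_p(\mu_1,\mu_2)=\inf_{\gamma\in\Gamma(\mu_1,\mu_2)}\left(\int_{X\times X}d^p(x_1,x_2)\,\mathrm{d}\gamma(x_1,x_2)\right)^{1/p}\in[0,\infty],$$ where $\Gamma(\mu_1,\mu_2)$ is the set of probability measures on $X\times X$ with marginals $\mu_1$ and $\mu_2$; this is defined for all measures in $\mathcal{P}(X)$, not only those with finite $p$-th moment. A measure $\mu\in\mathcal{P}(X)$ has a finite $p$-th moment if $\int_X d^p(x,x_0)\,\mathrm{d}\mu(x)<\infty$ for some (equivalently, every) $x_0\in X$. "Weakly" refers to the topology of weak convergence on $\mathcal{P}(X)$: $\mu^k\to\mu$ weakly if $\int_X g\,\mathrm{d}\mu^k\to\int_X g\,\mathrm{d}\mu$ for every bounded continuous $g:X\to\mathbb{R}$. *)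

theory Defs
  imports "HOL-Probability.Probability"
begin

definition borel_probs :: "'a::topological_space measure set" where
  "borel_probs = {\<mu>. prob_space \<mu> \<and> sets \<mu> = sets borel}"

text \<open>A power of an extended nonnegative real; only meant for exponents \<open>a > 0\<close>, where
  \<open>\<infinity>\<close> is mapped to \<open>\<infinity>\<close> and \<open>0\<close> to \<open>0\<close>.\<close>

definition ennreal_powr :: "ennreal \<Rightarrow> real \<Rightarrow> ennreal" where
  "ennreal_powr x a = (if x = \<infinity> then \<infinity> else ennreal (enn2real x powr a))"

text \<open>On a second countable space the product of the Borel sigma-algebras is the Borel
  sigma-algebra of the product, see \<open>borel_prod\<close>.\<close>

definition couplings ::
  "'a::second_countable_topology measure \<Rightarrow> 'a measure \<Rightarrow> ('a \<times> 'a) measure set" where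
  "couplings \<mu>\<^sub>1 \<mu>\<^sub>2 =
    {\<gamma> \<in> borel_probs. distr \<gamma> borel fst = \<mu>\<^sub>1 \<and> distr \<gamma> borel snd = \<mu>\<^sub>2}"

definition wasserstein :: "real \<Rightarrow> 'a::polish_space measure \<Rightarrow> 'a measure \<Rightarrow> ennreal" where
  "wasserstein p \<mu>\<^sub>1 \<mu>\<^sub>2 =
    (INF \<gamma>\<in>couplings \<mu>\<^sub>1 \<mu>\<^sub>2.
      ennreal_powr (\<integral>\<^sup>+ z. ennreal (dist (fst z) (snd z) powr p) \<partial>\<gamma>) (1 / p))"

definition finite_moment :: "real \<Rightarrow> 'a::metric_space measure \<Rightarrow> bool" where
  "finite_moment p \<mu> \<longleftrightarrow> (\<exists>x\<^sub>0. (\<integral>\<^sup>+ x. ennreal (dist x x\<^sub>0 powr p) \<partial>\<mu>) < \<infinity>)"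

definition wasserstein_ball ::
  "real \<Rightarrow> real \<Rightarrow> 'a::polish_space measure \<Rightarrow> 'a measure set" where
  "wasserstein_ball p r \<nu> = {\<mu> \<in> borel_probs. wasserstein p \<mu> \<nu> \<le> ennreal r}"

text \<open>The coarsest topology on the Borel probability measures for which \<open>\<mu> \<mapsto> \<integral>g d\<mu>\<close> is continuous
  for every bounded continuous \<open>g\<close>.\<close>

definition weak_topology :: "'a::topological_space measure topology" where
  "weak_topology = topology_generated_by
    {{\<mu> \<in> borel_probs. (\<integral>x. g x \<partial>\<mu>) \<in> U} | (g :: 'a \<Rightarrow> real) U.
      continuous_on UNIV g \<and> bounded (range g) \<and> open U}"

lemma topspace_weak_topology [simp]: "topspace weak_topology = borel_probs"
proof -
  have "borel_probs = {\<mu> \<in> borel_probs. (\<integral>x. (0::real) \<partial>\<mu>) \<in> UNIV}"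
    by simp
  moreover have "continuous_on UNIV (\<lambda>x::'a. 0::real)" "bounded (range (\<lambda>x::'a. 0::real))"
    "open (UNIV :: real set)"
    by auto
  ultimately have "(borel_probs :: 'a measure set) \<in>
    {{\<mu> \<in> borel_probs. (\<integral>x. g x \<partial>\<mu>) \<in> U} | (g :: 'a \<Rightarrow> real) U.
      continuous_on UNIV g \<and> bounded (range g) \<and> open U}"
    by blast
  then show ?thesis
    unfolding weak_topology_def topology_generated_by_topspace by blast
qed

lemma limitin_weak_topology_iff:
  "limitin weak_topology M \<mu> F \<longleftrightarrow>
    \<mu> \<in> borel_probs \<and> (\<forall>\<^sub>F k in F. M k \<in> borel_probs) \<and>
    (\<forall>g :: 'a::topological_space \<Rightarrow> real. continuous_on UNIV g \<and> bounded (range g) \<longrightarrow>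
      ((\<lambda>k. \<integral>x. g x \<partial>M k) \<longlongrightarrow> (\<integral>x. g x \<partial>\<mu>)) F)"
  (is "?L \<longleftrightarrow> ?R")
proof
  assume L: ?L
  have mu: "\<mu> \<in> borel_probs"
    using limitin_topspace[OF L] by simp
  have ev: "\<forall>\<^sub>F k in F. M k \<in> borel_probs"
    using L openin_topspace[of "weak_topology :: 'a measure topology"] mu
    unfolding limitin_def by auto
  have "((\<lambda>k. \<integral>x. g x \<partial>M k) \<longlongrightarrow> (\<integral>x. g x \<partial>\<mu>)) F"
    if g: "continuous_on UNIV g" "bounded (range g)" for g :: "'a \<Rightarrow> real"
  proof (rule topological_tendstoI)
    fix U :: "real set"
    assume U: "open U" "(\<integral>x. g x \<partial>\<mu>) \<in> U"
    have "openin weak_topology {\<mu> \<in> borel_probs. (\<integral>x. g x \<partial>\<mu>) \<in> U}"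
      unfolding weak_topology_def using g U by (intro topology_generated_by_Basis) blast
    then have "\<forall>\<^sub>F k in F. M k \<in> {\<mu> \<in> borel_probs. (\<integral>x. g x \<partial>\<mu>) \<in> U}"
      using L mu U unfolding limitin_def by blast
    then show "\<forall>\<^sub>F k in F. (\<integral>x. g x \<partial>M k) \<in> U"
      by (rule eventually_mono) auto
  qed
  with mu ev show ?R by blast
next
  assume R: ?R
  have "\<forall>\<^sub>F k in F. M k \<in> V" if "openin weak_topology V" "\<mu> \<in> V" for V
  proof -
    from that(1) have "generate_topology_on
      {{\<mu> \<in> borel_probs. (\<integral>x. g x \<partial>\<mu>) \<in> U} | (g :: 'a \<Rightarrow> real) U.
        continuous_on UNIV g \<and> bounded (range g) \<and> open U} V"
      unfolding weak_topology_def by (rule openin_topology_generated_by)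
    then show ?thesis using that(2)
    proof (induction rule: generate_topology_on.induct)
      case Empty
      then show ?case by simp
    next
      case (Int a b)
      then show ?case by (auto intro: eventually_conj)
    next
      case (UN K)
      then obtain k where k: "k \<in> K" "\<mu> \<in> k" by blast
      then have "\<forall>\<^sub>F j in F. M j \<in> k" using UN by blast
      then show ?case by (rule eventually_mono) (use k in blast)
    next
      case (Basis s)
      then obtain g :: "'a \<Rightarrow> real" and U where s: "s = {\<mu> \<in> borel_probs. (\<integral>x. g x \<partial>\<mu>) \<in> U}"
        and g: "continuous_on UNIV g" "bounded (range g)" "open U"
        by blast
      have "\<forall>\<^sub>F k in F. (\<integral>x. g x \<partial>M k) \<in> U"
        using R g Basis s by (auto dest: topological_tendstoD)
      with R have "\<forall>\<^sub>F k in F. M k \<in> borel_probs \<and> (\<integral>x. g x \<partial>M k) \<in> U"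
        by (auto intro: eventually_conj)
      then show ?case unfolding s by simp
    qed
  qed
  with R show ?L
    unfolding limitin_def by simp
qed

end

theory Submission
  imports Defs
begin

text \<open>
  The ball is a continuous image of a weakly compact set of transport plans. Let \<open>plans p s \<nu>\<close> be
  the set of all probability measures on the product space with second marginal \<open>\<nu>\<close> and cost
  \<open>\<integral> d\<^sup>p\<close> at most \<open>s\<close>; the first marginal is left free. It is weakly closed, because fixing a
  marginal amounts to fixing integrals of bounded continuous functions, and the cost is the
  supremum over \<open>n\<close> of the integrals of the bounded continuous functions \<open>min d\<^sup>p n\<close>. It is tight:
  a pair \<open>(x, y)\<close> with \<open>x\<close> far from a base point has either \<open>y\<close> far from it, which is unlikely
  under the fixed law \<open>\<nu>\<close>, or \<open>d x y\<close> large, which is unlikely by Markov's inequality; outside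
  these events the pair lies in a product of two balls, which is compact as the space is proper.
  Closed tight sets are weakly compact (\<open>tight_closedin_imp_compactin_weak\<close>). Nested nonempty compact
  sets of almost optimal plans then give an optimal plan, so the ball of radius \<open>r\<close> is exactly the
  set of first marginals of \<open>plans p (r powr p) \<nu>\<close> (\<open>wasserstein_le_iff_plan\<close>), and taking the
  first marginal is weakly continuous.

  The compactness of closed tight sets is the direction of Prokhorov's theorem that takes work.
  A measure is viewed as the functional \<open>g \<mapsto> \<integral> g d\<mu>\<close> on the continuous functions with values in
  \<open>[0, 1]\<close>. The normalized, additive, nonnegative functionals satisfying fixed tightness bounds are
  cut out of the product space of all functions by closed conditions on finitely many coordinates
  each, so they form a compact set by Tychonoff's theorem. Every such functional is integration
  against a probability measure (\<open>integral_riesz_measure\<close>, a form of the Riesz representation theorem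
  in which tightness replaces local compactness), and passing to that measure is continuous.
\<close>

section \<open>Continuous functions into the unit interval\<close>

text \<open>Functions with values in \<open>[0, 1]\<close> rather than bounded functions: a normalized functional then
  maps each of them into the compact interval \<open>[0, 1]\<close>, as Tychonoff's theorem requires.\<close>

definition unit_functions :: "('a::topological_space \<Rightarrow> real) set" where
  "unit_functions = {g. continuous_on UNIV g \<and> (\<forall>x. 0 \<le> g x \<and> g x \<le> 1)}"

lemma unit_functionsI:
  assumes "continuous_on UNIV g" "\<And>x. 0 \<le> g x" "\<And>x. g x \<le> 1"
  shows "g \<in> unit_functions"
  using assms by (simp add: unit_functions_def)

lemma unit_functionsD:
  assumes "g \<in> unit_functions"
  shows "continuous_on UNIV g" "0 \<le> g x" "g x \<le> 1"
  using assms by (simp_all add: unit_functions_def)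

lemma unit_functions_const: "0 \<le> c \<Longrightarrow> c \<le> 1 \<Longrightarrow> (\<lambda>x. c) \<in> unit_functions"
  by (intro unit_functionsI) auto

lemma unit_functions_diff:
  assumes "f \<in> unit_functions" "g \<in> unit_functions" "\<And>x. f x \<le> g x"
  shows "(\<lambda>x. g x - f x) \<in> unit_functions"
proof (intro unit_functionsI)
  show "continuous_on UNIV (\<lambda>x. g x - f x)"
    using assms by (intro continuous_intros unit_functionsD)
  fix x
  show "0 \<le> g x - f x" "g x - f x \<le> 1"
    using unit_functionsD(2,3)[OF assms(1), of x] unit_functionsD(2,3)[OF assms(2), of x] assms(3)[of x]
    by auto
qed

lemma unit_functions_min:
  assumes "g \<in> unit_functions" "continuous_on UNIV f" "\<And>x. 0 \<le> f x"
  shows "(\<lambda>x. min (g x) (f x)) \<in> unit_functions"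
  using assms unit_functionsD[OF assms(1)]
  by (intro unit_functionsI continuous_intros) (auto simp: min_le_iff_disj)

lemma unit_functions_truncate:
  assumes "g \<in> unit_functions" "0 \<le> c"
  shows "(\<lambda>x. max (g x - c) 0) \<in> unit_functions"
proof (intro unit_functionsI)
  show "continuous_on UNIV (\<lambda>x. max (g x - c) 0)"
    using unit_functionsD(1)[OF assms(1)] by (intro continuous_intros)
  show "max (g x - c) 0 \<le> 1" for x
    using unit_functionsD(3)[OF assms(1), of x] assms(2) by auto
qed auto

text \<open>The case distinction is there because \<open>infdist x {}\<close> is \<open>0\<close>.\<close>

definition cutoff :: "'a::metric_space set \<Rightarrow> nat \<Rightarrow> 'a \<Rightarrow> real" where
  "cutoff U n x = (if U = UNIV then 1 else min 1 (real n * infdist x (- U)))"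

lemma cutoff_unit_functions: "cutoff U n \<in> unit_functions"
  unfolding cutoff_def[abs_def]
  by (cases "U = UNIV") (auto intro!: unit_functionsI continuous_intros mult_nonneg_nonneg infdist_nonneg)

lemma cutoff_outside: "x \<notin> U \<Longrightarrow> cutoff U n x = 0"
  by (auto simp: cutoff_def)

lemma cutoff_mono: "m \<le> n \<Longrightarrow> cutoff U m x \<le> cutoff U n x"
  unfolding cutoff_def by (auto intro!: min.mono mult_right_mono infdist_nonneg simp del: min.bounded_iff)

lemma cutoff_eventually_1:
  assumes "open U" "x \<in> U"
  shows "\<exists>n. \<forall>m\<ge>n. cutoff U m x = 1"
proof (cases "U = UNIV")
  case False
  then have pos: "infdist x (- U) > 0"
    using assms by (intro infdist_pos_not_in_closed) auto
  then obtain n where "1 < real n * infdist x (- U)"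
    using reals_Archimedean3 by blast
  then have "cutoff U n x = 1"
    using False by (simp add: cutoff_def)
  then have "cutoff U m x = 1" if "n \<le> m" for m
    using cutoff_mono[OF that, of U x] unit_functionsD(3)[OF cutoff_unit_functions, of U m x] by simp
  then show ?thesis by blast
qed (auto simp: cutoff_def)

lemma cutoff_tendsto_indicator:
  assumes "open U"
  shows "(\<lambda>n. cutoff U n x) \<longlonglongrightarrow> indicator U x"
proof (cases "x \<in> U")
  case True
  then obtain n where "\<forall>m\<ge>n. cutoff U m x = 1"
    using cutoff_eventually_1[OF assms] by blast
  then have "\<forall>\<^sub>F m in sequentially. cutoff U m x = 1"
    by (auto simp: eventually_sequentially)
  then show ?thesis
    using True by (simp add: tendsto_eventually)
qed (simp add: cutoff_outside)

lemma borel_probsD: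
  assumes "\<mu> \<in> borel_probs"
  shows "prob_space \<mu>" "sets \<mu> = sets borel" "space \<mu> = UNIV"
  using assms sets_eq_imp_space_eq[of \<mu> borel] by (auto simp: borel_probs_def)

lemma continuous_borel_probs_measurable:
  fixes g :: "'a::topological_space \<Rightarrow> real"
  assumes "\<mu> \<in> borel_probs" "continuous_on UNIV g"
  shows "g \<in> borel_measurable \<mu>"
  using borel_measurable_continuous_onI[OF assms(2)] borel_probsD(2)[OF assms(1)]
  by (simp cong: measurable_cong_sets)

lemma bounded_continuous_integrable:
  fixes g :: "'a::topological_space \<Rightarrow> real"
  assumes "\<mu> \<in> borel_probs" "continuous_on UNIV g" "bounded (range g)"
  shows "integrable \<mu> g"
proof -
  interpret prob_space \<mu> using borel_probsD(1)[OF assms(1)] .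
  obtain B where "\<And>x. norm (g x) \<le> B"
    using assms(3) by (auto simp: bounded_iff)
  then show ?thesis
    using continuous_borel_probs_measurable[OF assms(1,2)]
    by (intro integrable_const_bound[where B=B]) auto
qed

lemma unit_functions_bounded:
  assumes "g \<in> unit_functions"
  shows "bounded (range g)"
  using unit_functionsD(2,3)[OF assms] by (intro boundedI[where B=1]) auto

lemma unit_functions_integrable:
  "\<mu> \<in> borel_probs \<Longrightarrow> g \<in> unit_functions \<Longrightarrow> integrable \<mu> g"
  by (simp add: bounded_continuous_integrable unit_functions_bounded unit_functionsD(1))

lemma integral_cutoff_tendsto:
  fixes \<mu> :: "'a::metric_space measure"
  assumes mu: "\<mu> \<in> borel_probs" and "open U"
  shows "(\<lambda>n. \<integral>x. cutoff U n x \<partial>\<mu>) \<longlonglongrightarrow> measure \<mu> U"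
proof -
  interpret prob_space \<mu> using borel_probsD(1)[OF mu] .
  have U: "U \<in> sets \<mu>"
    using assms borel_probsD(2)[OF mu] by simp
  have "(\<lambda>n. \<integral>x. cutoff U n x \<partial>\<mu>) \<longlonglongrightarrow> (\<integral>x. indicator U x \<partial>\<mu>)"
  proof (rule integral_dominated_convergence[where w="\<lambda>_. 1"])
    show "AE x in \<mu>. norm (cutoff U n x) \<le> 1" for n
      using unit_functionsD[OF cutoff_unit_functions, of U n] by auto
    show "cutoff U n \<in> borel_measurable \<mu>" for n
      using continuous_borel_probs_measurable[OF mu] unit_functionsD(1)[OF cutoff_unit_functions] by blast
  qed (use U cutoff_tendsto_indicator[OF \<open>open U\<close>] in auto)
  then show ?thesis
    using U by simp
qed

text \<open>Cutoff functions recover the measure of every open set, and the open sets are closed under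
  intersection and generate the Borel sets.\<close>

lemma borel_probs_eqI:
  fixes \<mu> \<mu>' :: "'a::metric_space measure"
  assumes mu: "\<mu> \<in> borel_probs" "\<mu>' \<in> borel_probs"
    and eq: "\<And>g. g \<in> unit_functions \<Longrightarrow> (\<integral>x. g x \<partial>\<mu>) = (\<integral>x. g x \<partial>\<mu>')"
  shows "\<mu> = \<mu>'"
proof (rule measure_eqI_generator_eq[of "{U. open U}" UNIV _ _ "\<lambda>_. UNIV"])
  interpret m: prob_space \<mu> using borel_probsD(1)[OF mu(1)] .
  interpret m': prob_space \<mu>' using borel_probsD(1)[OF mu(2)] .
  show "emeasure \<mu> U = emeasure \<mu>' U" if "U \<in> {U. open U}" for U
  proof -
    have U: "open U" using that by simp
    have "(\<lambda>n. \<integral>x. cutoff U n x \<partial>\<mu>) \<longlonglongrightarrow> measure \<mu>' U"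
      using integral_cutoff_tendsto[OF mu(2) U] eq[OF cutoff_unit_functions] by simp
    then have "measure \<mu> U = measure \<mu>' U"
      using integral_cutoff_tendsto[OF mu(1) U] LIMSEQ_unique by blast
    then show ?thesis
      by (simp add: m.emeasure_eq_measure m'.emeasure_eq_measure)
  qed
  show "Int_stable {U :: 'a set. open U}"
    by (auto simp: Int_stable_def)
  show "emeasure \<mu> UNIV \<noteq> \<infinity>"
    by simp
qed (use mu in \<open>auto simp: borel_probs_def borel_def\<close>)

section \<open>A Riesz representation theorem for tight functionals\<close>

text \<open>All conditions constrain finitely many
  values of \<open>L\<close> by weak inequalities or equations, which makes the set of these functionals closed
  under pointwise limits. The set \<open>K n\<close> is meant to carry all but \<open>1 / Suc n\<close> of the mass; the last
  condition says so without mentioning a measure.\<close>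

locale tight_functional =
  fixes L :: "('a::metric_space \<Rightarrow> real) \<Rightarrow> real" and K :: "nat \<Rightarrow> 'a set"
  assumes nonneg: "g \<in> unit_functions \<Longrightarrow> 0 \<le> L g"
    and one: "L (\<lambda>_. 1) = 1"
    and add: "f \<in> unit_functions \<Longrightarrow> g \<in> unit_functions \<Longrightarrow> (\<lambda>x. f x + g x) \<in> unit_functions \<Longrightarrow>
      L (\<lambda>x. f x + g x) = L f + L g"
    and compact: "compact (K n)"
    and tight: "g \<in> unit_functions \<Longrightarrow> (\<And>x. x \<in> K n \<Longrightarrow> g x = 0) \<Longrightarrow> L g \<le> 1 / Suc n"
begin

lemma diff:
  assumes "f \<in> unit_functions" "g \<in> unit_functions" "\<And>x. f x \<le> g x"
  shows "L g = L f + L (\<lambda>x. g x - f x)"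
  using add[OF assms(1) unit_functions_diff[OF assms]] assms(2) by simp

lemma mono:
  assumes "f \<in> unit_functions" "g \<in> unit_functions" "\<And>x. f x \<le> g x"
  shows "L f \<le> L g"
  using diff[OF assms] nonneg[OF unit_functions_diff[OF assms]] by simp

lemma zero: "L (\<lambda>_. 0) = 0"
  using add[of "\<lambda>_. 0" "\<lambda>_. 0"] unit_functions_const[of 0] by simp

lemma le_one: "g \<in> unit_functions \<Longrightarrow> L g \<le> 1"
  using mono[of g "\<lambda>_. 1"] unit_functions_const[of 1] unit_functionsD(3) one by auto

lemma scale:
  assumes g: "g \<in> unit_functions" and "\<And>x. real k * g x \<le> 1"
  shows "L (\<lambda>x. real k * g x) = real k * L g"
  using assms(2)
proof (induction k)
  case 0
  then show ?case by (simp add: zero)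
next
  case (Suc k)
  have le: "real k * g x \<le> 1" for x
    using Suc.prems[of x] unit_functionsD(2)[OF g, of x] by (simp add: algebra_simps)
  have G: "(\<lambda>x. real m * g x) \<in> unit_functions" if "\<And>x. real m * g x \<le> 1" for m
    using that unit_functionsD(1,2)[OF g] by (intro unit_functionsI continuous_intros) auto
  have "L (\<lambda>x. real k * g x + g x) = L (\<lambda>x. real k * g x) + L g"
    using G[OF le] G[OF Suc.prems] g by (intro add) (simp_all add: algebra_simps)
  then show ?case
    using Suc.IH[OF le] by (simp add: algebra_simps)
qed

lemma const: "L (\<lambda>_. 1 / Suc n) = 1 / Suc n"
  using scale[of "\<lambda>_. 1 / Suc n" "Suc n"] unit_functions_const[of "1 / Suc n"] one
  by (simp add: field_simps del: of_nat_Suc)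

text \<open>The sum of the \<open>f i\<close> may exceed \<open>1\<close> and so be outside the domain of \<open>L\<close>; hence \<open>g\<close> is split
  into one piece below each \<open>f i\<close>.\<close>

lemma le_sum:
  fixes n :: nat
  assumes "\<And>i. f i \<in> unit_functions" "g \<in> unit_functions" "\<And>x. g x \<le> (\<Sum>i<n. f i x)"
  shows "L g \<le> (\<Sum>i<n. L (f i))"
  using assms(2,3)
proof (induction n arbitrary: g)
  case 0
  then have "g = (\<lambda>_. 0)"
    using unit_functionsD(2)[OF 0(1)] by (auto simp: fun_eq_iff intro: antisym)
  then show ?case by (simp add: zero)
next
  case (Suc n)
  \<comment> \<open>the part of \<open>g\<close> absorbed by the first \<open>n\<close> functions; the rest is below \<open>f n\<close>\<close>
  define h where "h x = min (g x) (\<Sum>i<n. f i x)" for x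
  have h: "h \<in> unit_functions"
    unfolding h_def[abs_def]
    by (intro unit_functions_min Suc.prems(1) continuous_intros sum_nonneg unit_functionsD[OF assms(1)])
  have "h x \<le> g x" for x by (simp add: h_def)
  then have "L g = L h + L (\<lambda>x. g x - h x)"
    and "(\<lambda>x. g x - h x) \<in> unit_functions"
    using diff[OF h Suc.prems(1)] unit_functions_diff[OF h Suc.prems(1)] by auto
  moreover have "L h \<le> (\<Sum>i<n. L (f i))"
    by (intro Suc.IH h) (simp add: h_def)
  moreover have "g x - h x \<le> f n x" for x
    using Suc.prems(2)[of x] unit_functionsD(2)[OF assms(1), of n x] by (auto simp: h_def min_def)
  ultimately show ?case
    using mono[of "\<lambda>x. g x - h x" "f n"] assms(1) by auto
qed

lemma small_on_compact:
  assumes h: "h \<in> unit_functions" and small: "\<And>x. x \<in> K n \<Longrightarrow> h x \<le> 1 / Suc n"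
  shows "L h \<le> 2 / Suc n"
proof -
  define c :: real where "c = 1 / Suc n"
  have c: "0 \<le> c" "c \<le> 1" by (auto simp: c_def)
  define u where "u x = min (h x) c" for x
  have u: "u \<in> unit_functions"
    unfolding u_def using h c by (intro unit_functions_min) auto
  have eq: "h x - u x = max (h x - c) 0" for x
    by (auto simp: u_def)
  have "L h = L u + L (\<lambda>x. h x - u x)"
    by (intro diff u h) (simp add: u_def)
  moreover have "L u \<le> c"
    using mono[OF u unit_functions_const[OF c]] const[of n] by (simp add: u_def c_def)
  moreover have "L (\<lambda>x. max (h x - c) 0) \<le> 1 / Suc n"
    using h c small by (intro tight unit_functions_truncate) (auto simp: c_def)
  ultimately show ?thesis
    by (simp add: eq c_def)
qed

text \<open>Continuity of \<open>L\<close> along increasing sequences. As in Dini's theorem, the convergence is uniform on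
  the compact set \<open>K n\<close>, and off \<open>K n\<close> tightness makes the difference negligible. This is the only
  source of countable additivity for the measure below.\<close>

lemma monotone_limit_le:
  assumes g: "\<And>n. g n \<in> unit_functions" and h: "h \<in> unit_functions"
    and inc: "\<And>m n x. m \<le> n \<Longrightarrow> g m x \<le> g n x" and le: "\<And>n x. g n x \<le> h x"
    and lim: "\<And>x. (\<lambda>n. g n x) \<longlonglongrightarrow> h x"
    and c: "\<And>n. L (g n) \<le> c"
  shows "L h \<le> c"
proof -
  have "L h \<le> c + 2 / Suc n" for n
  proof -
    define U where "U m = {x. h x - g m x < 1 / Suc n}" for m
    have "open (U m)" for m
      unfolding U_def using unit_functionsD(1)[OF g] unit_functionsD(1)[OF h]
      by (intro open_Collect_less continuous_intros)
    moreover have "K n \<subseteq> (\<Union>m. U m)"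
    proof
      fix x
      have "(\<lambda>m. h x - g m x) \<longlonglongrightarrow> h x - h x"
        by (intro tendsto_intros lim)
      then have "\<forall>\<^sub>F m in sequentially. h x - g m x < 1 / Suc n"
        by (intro order_tendstoD) auto
      then show "x \<in> (\<Union>m. U m)"
        unfolding U_def using eventually_happens by fastforce
    qed
    ultimately obtain F where F: "finite F" "K n \<subseteq> (\<Union>m\<in>F. U m)"
      using compactE_image[OF compact[of n], of UNIV U] by auto
    define m where "m = Max (insert 0 F)"
    have "h x - g m x \<le> 1 / Suc n" if "x \<in> K n" for x
    proof -
      obtain k where k: "k \<in> F" "x \<in> U k" using F(2) \<open>x \<in> K n\<close> by blast
      then have "k \<le> m" using F by (simp add: m_def)
      then show ?thesis
        using inc[of k m x] k by (simp add: U_def)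
    qed
    then have "L (\<lambda>x. h x - g m x) \<le> 2 / Suc n"
      using g h le by (intro small_on_compact unit_functions_diff)
    then show ?thesis
      using diff[OF g h le, of m] c[of m] by simp
  qed
  moreover have "(\<lambda>n. c + 2 / real (Suc n)) \<longlonglongrightarrow> c + 0"
    using tendsto_mult_right[OF LIMSEQ_inverse_real_of_nat, of 2]
    by (intro tendsto_add tendsto_const) (simp add: field_simps del: of_nat_Suc)
  ultimately show ?thesis
    by (intro LIMSEQ_le_const[of "\<lambda>n. c + 2 / real (Suc n)" c]) auto
qed

text \<open>The value is of interest for open \<open>U\<close>, where it is the measure that a representing measure
  has to assign to \<open>U\<close>.\<close>

definition open_content :: "'a set \<Rightarrow> ennreal" where
  "open_content U = (SUP g\<in>{g \<in> unit_functions. \<forall>x. x \<notin> U \<longrightarrow> g x = 0}. ennreal (L g))"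

definition outer :: "'a set \<Rightarrow> ennreal" where
  "outer A = (INF U\<in>{U. open U \<and> A \<subseteq> U}. open_content U)"

lemma open_content_upper:
  "g \<in> unit_functions \<Longrightarrow> (\<And>x. x \<notin> U \<Longrightarrow> g x = 0) \<Longrightarrow> ennreal (L g) \<le> open_content U"
  unfolding open_content_def by (intro SUP_upper) auto

text \<open>The summand \<open>a\<close> allows estimates of sums of two contents to be reduced to functions one
  content at a time.\<close>

lemma open_content_least:
  assumes "\<And>g. g \<in> unit_functions \<Longrightarrow> (\<And>x. x \<notin> U \<Longrightarrow> g x = 0) \<Longrightarrow> ennreal (L g) + a \<le> c"
  shows "open_content U + a \<le> c"
proof -
  have ne: "{g \<in> unit_functions. \<forall>x. x \<notin> U \<longrightarrow> g x = 0} \<noteq> {}"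
    using unit_functions_const[of 0] by auto
  show ?thesis
    unfolding open_content_def ennreal_SUP_add_left[OF ne, symmetric]
    by (intro SUP_least assms) auto
qed

lemma open_content_mono: "U \<subseteq> V \<Longrightarrow> open_content U \<le> open_content V"
  unfolding open_content_def by (intro SUP_subset_mono) auto

lemma open_content_le_1: "open_content U \<le> 1"
  using open_content_least[of U 0 1] le_one by (simp add: ennreal_le_1)

text \<open>A function vanishing outside the union is the increasing limit of its minima with finite sums of
  cutoff functions of the \<open>U i\<close>.\<close>

lemma open_content_Union:
  fixes U :: "nat \<Rightarrow> 'a set"
  assumes "\<And>i. open (U i)"
  shows "open_content (\<Union>i. U i) \<le> (\<Sum>i. open_content (U i))"
proof (cases "(\<Sum>i. open_content (U i)) = \<top>")
  case False
  define c where "c = enn2real (\<Sum>i. open_content (U i))"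
  have c: "(\<Sum>i. open_content (U i)) = ennreal c"
    using False by (simp add: c_def less_top)
  have "ennreal (L g) \<le> ennreal c"
    if g: "g \<in> unit_functions" and out: "\<And>x. x \<notin> (\<Union>i. U i) \<Longrightarrow> g x = 0" for g
  proof (rule ennreal_leI, rule monotone_limit_le)
    define f where "f n x = min (g x) (\<Sum>i<n. cutoff (U i) n x)" for n x
    note cut = unit_functionsD[OF cutoff_unit_functions]
    show f: "f n \<in> unit_functions" for n
      unfolding f_def[abs_def] by (intro unit_functions_min g continuous_intros cut sum_nonneg)
    show "f m x \<le> f n x" if "m \<le> n" for m n x
    proof -
      have "(\<Sum>i<m. cutoff (U i) m x) \<le> (\<Sum>i<m. cutoff (U i) n x)"
        by (intro sum_mono cutoff_mono that)
      also have "\<dots> \<le> (\<Sum>i<n. cutoff (U i) n x)"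
        using that by (intro sum_mono2 cut) auto
      finally show ?thesis
        unfolding f_def by auto
    qed
    show "f n x \<le> g x" for n x
      by (simp add: f_def)
    show "(\<lambda>n. f n x) \<longlonglongrightarrow> g x" for x
    proof (cases "x \<in> (\<Union>i. U i)")
      case True
      then obtain i where i: "x \<in> U i" by blast
      obtain N where N: "\<And>n. N \<le> n \<Longrightarrow> cutoff (U i) n x = 1"
        using cutoff_eventually_1[OF assms i] by blast
      have "f n x = g x" if "n \<ge> max N (Suc i)" for n
      proof -
        have "cutoff (U i) n x \<le> (\<Sum>i<n. cutoff (U i) n x)"
          using that by (intro member_le_sum cut) auto
        then show ?thesis
          using N[of n] that unit_functionsD(3)[OF g, of x] by (simp add: f_def)
      qed
      then show ?thesis
        by (intro tendsto_eventually eventually_sequentiallyI)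
    next
      case False
      then have "f n x = g x" for n
        using out by (simp add: f_def cutoff_outside)
      then show ?thesis by simp
    qed
    show "L (f n) \<le> c" for n
    proof -
      have "L (f n) \<le> (\<Sum>i<n. L (cutoff (U i) n))"
        by (intro le_sum f cutoff_unit_functions) (simp add: f_def)
      then have "ennreal (L (f n)) \<le> (\<Sum>i<n. ennreal (L (cutoff (U i) n)))"
        by (simp add: sum_ennreal nonneg cutoff_unit_functions ennreal_leI)
      also have "\<dots> \<le> (\<Sum>i<n. open_content (U i))"
        by (intro sum_mono open_content_upper cutoff_unit_functions cutoff_outside)
      also have "\<dots> \<le> ennreal c"
        unfolding c[symmetric] by (intro sum_le_suminf) auto
      finally show ?thesis
        by (simp add: c_def)
    qed
  qed (use g in auto)
  then show ?thesis
    using open_content_least[of "\<Union>i. U i" 0 "ennreal c"] by (simp add: c)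
qed simp

lemma outer_le_open_content: "open U \<Longrightarrow> A \<subseteq> U \<Longrightarrow> outer A \<le> open_content U"
  unfolding outer_def by (intro INF_lower) auto

lemma outer_open: "open U \<Longrightarrow> outer U = open_content U"
  by (intro antisym outer_le_open_content) (auto simp: outer_def intro!: INF_greatest open_content_mono)

lemma outer_mono: "A \<subseteq> B \<Longrightarrow> outer A \<le> outer B"
  unfolding outer_def by (intro INF_superset_mono) auto

lemma outer_le_1: "outer A \<le> 1"
  using outer_le_open_content[of UNIV A] open_content_le_1 order_trans by blast

lemma outer_empty: "outer {} = 0"
proof -
  have "ennreal (L g) + 0 \<le> 0" if "\<And>x. x \<notin> {} \<Longrightarrow> g x = 0" for g
  proof -
    have "g = (\<lambda>_. 0)" using that by auto
    then show ?thesis by (simp add: zero)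
  qed
  then have "open_content {} + 0 \<le> 0"
    by (rule open_content_least)
  then show ?thesis
    using outer_open[of "{}"] by simp
qed

lemma outer_Union:
  fixes A :: "nat \<Rightarrow> 'a set"
  shows "outer (\<Union>i. A i) \<le> (\<Sum>i. outer (A i))"
proof (rule ennreal_le_epsilon)
  fix e :: real
  assume e: "0 < e"
  \<comment> \<open>the errors allowed for the single sets sum up to \<open>e\<close>\<close>
  define d where "d i = e * (1/2) ^ Suc i" for i
  have d: "0 < d i" for i using e by (simp add: d_def)
  have "\<exists>U. open U \<and> A i \<subseteq> U \<and> open_content U < outer (A i) + ennreal (d i)" for i
  proof -
    have "outer (A i) < \<top>"
      using outer_le_1[of "A i"] by (simp add: order_le_less_trans)
    then have "outer (A i) < outer (A i) + ennreal (d i)"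
      using d[of i] by (simp add: ennreal_add_left_cancel_less)
    then show ?thesis
      unfolding outer_def[of "A i"] by (auto simp: INF_less_iff)
  qed
  then obtain U where U: "\<And>i. open (U i)" "\<And>i. A i \<subseteq> U i"
    "\<And>i. open_content (U i) \<le> outer (A i) + ennreal (d i)"
    unfolding less_le by metis
  have "outer (\<Union>i. A i) \<le> open_content (\<Union>i. U i)"
    using U by (intro outer_le_open_content) auto
  also have "\<dots> \<le> (\<Sum>i. open_content (U i))"
    by (intro open_content_Union U)
  also have "\<dots> \<le> (\<Sum>i. outer (A i) + ennreal (d i))"
    by (intro suminf_le U summableI)
  also have "\<dots> = (\<Sum>i. outer (A i)) + (\<Sum>i. ennreal (d i))"
    by (intro suminf_add[symmetric] summableI)
  also have "(\<Sum>i. ennreal (d i)) = ennreal e"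
  proof -
    have "d sums (e * 1)"
      unfolding d_def[abs_def] by (intro sums_mult power_half_series)
    then have "(\<lambda>i. ennreal (d i)) sums ennreal e"
      using d e by (simp add: less_imp_le)
    then show ?thesis
      by (rule sums_unique[symmetric])
  qed
  finally show "outer (\<Union>i. A i) \<le> (\<Sum>i. outer (A i)) + ennreal e" .
qed

lemma outer_Un: "outer (A \<union> B) \<le> outer A + outer B"
  using outer_Union[of "binaryset A B"]
  unfolding UN_binaryset_eq suminf_binaryset_eq[of outer, OF outer_empty] .

text \<open>Caratheodory's criterion for open \<open>U\<close>. Given open \<open>V\<close> around \<open>A\<close> and a function \<open>g\<close> living on
  \<open>U \<inter> V\<close>, lowering \<open>g\<close> by a small \<open>d\<close> costs at most \<open>d\<close> and separates it from the open set
  \<open>W = V \<inter> {g < d}\<close>, which still covers \<open>A - U\<close>. Functions living on \<open>W\<close> can thus be added to the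
  lowered \<open>g\<close> without exceeding \<open>1\<close>.\<close>

lemma outer_split_open:
  assumes "open U"
  shows "outer (U \<inter> A) + outer (A - U) = outer A"
proof (rule antisym)
  have "(U \<inter> A) \<union> (A - U) = A" by blast
  then show "outer A \<le> outer (U \<inter> A) + outer (A - U)"
    using outer_Un[of "U \<inter> A" "A - U"] by simp
  show "outer (U \<inter> A) + outer (A - U) \<le> outer A"
    unfolding outer_def[of A]
  proof (rule INF_greatest)
    fix V
    assume "V \<in> {V. open V \<and> A \<subseteq> V}"
    then have V: "open V" "A \<subseteq> V" by auto
    have "open_content (U \<inter> V) + outer (A - U) \<le> open_content V"
    proof (rule open_content_least, rule ennreal_le_epsilon)
      fix g :: "'a \<Rightarrow> real" and e :: real
      assume g: "g \<in> unit_functions" and out: "\<And>x. x \<notin> U \<inter> V \<Longrightarrow> g x = 0" and e: "0 < e"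
      obtain n where n: "1 / real (Suc n) < e"
        using nat_approx_posE[OF e] by blast
      define d :: real where "d = 1 / real (Suc n)"
      have d: "0 < d" "d \<le> 1" "d < e" using n by (auto simp: d_def)
      define g' where "g' x = max (g x - d) 0" for x
      have g': "g' \<in> unit_functions"
        unfolding g'_def[abs_def] using g d by (intro unit_functions_truncate) auto
      have g'_le: "g' x \<le> g x" for x
        using unit_functionsD(2)[OF g, of x] d by (simp add: g'_def)
      define W where "W = V \<inter> {x. g x < d}"
      have W: "open W"
        unfolding W_def using V unit_functionsD(1)[OF g]
        by (intro open_Int open_Collect_less continuous_intros) auto
      have "A - U \<subseteq> W"
        using V out d by (auto simp: W_def)
      then have "outer (A - U) \<le> open_content W"
        by (intro outer_le_open_content W)
      have "open_content W + ennreal (L g') \<le> open_content V"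
      proof (rule open_content_least)
        fix h :: "'a \<Rightarrow> real"
        assume h: "h \<in> unit_functions" and hout: "\<And>x. x \<notin> W \<Longrightarrow> h x = 0"
        have dis: "h x = 0 \<or> g' x = 0" for x
          using hout[of x] by (cases "x \<in> W") (auto simp: W_def g'_def)
        have hg: "(\<lambda>x. h x + g' x) \<in> unit_functions"
        proof (rule unit_functionsI)
          show "continuous_on UNIV (\<lambda>x. h x + g' x)"
            by (intro continuous_intros unit_functionsD h g')
          show "0 \<le> h x + g' x" "h x + g' x \<le> 1" for x
            using dis[of x] unit_functionsD(2,3)[OF h, of x] unit_functionsD(2,3)[OF g', of x]
            by auto
        qed
        have "ennreal (L h) + ennreal (L g') = ennreal (L (\<lambda>x. h x + g' x))"
          using add[OF h g' hg] nonneg[OF h] nonneg[OF g'] by simp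
        also have "\<dots> \<le> open_content V"
        proof (rule open_content_upper[OF hg])
          fix x assume "x \<notin> V"
          then show "h x + g' x = 0"
            using hout[of x] out[of x] d by (simp add: W_def g'_def)
        qed
        finally show "ennreal (L h) + ennreal (L g') \<le> open_content V" .
      qed
      moreover have "L g \<le> L g' + e"
      proof -
        have "L (\<lambda>x. g x - g' x) \<le> L (\<lambda>_. d)"
          using d unit_functionsD(2)[OF g]
          by (intro mono unit_functions_diff g g' g'_le unit_functions_const) (auto simp: g'_def)
        then show ?thesis
          using diff[OF g' g g'_le] const[of n] d by (simp add: d_def)
      qed
      then have "ennreal (L g) \<le> ennreal (L g') + ennreal e"
        using nonneg[OF g'] e by (simp add: ennreal_leI flip: ennreal_plus)
      ultimately show "ennreal (L g) + outer (A - U) \<le> open_content V + ennreal e"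
      proof -
        assume W_V: "open_content W + ennreal (L g') \<le> open_content V"
          and L_g: "ennreal (L g) \<le> ennreal (L g') + ennreal e"
        have "ennreal (L g) + outer (A - U) \<le> (ennreal (L g') + ennreal e) + open_content W"
          by (intro add_mono L_g \<open>outer (A - U) \<le> open_content W\<close>)
        also have "\<dots> = (open_content W + ennreal (L g')) + ennreal e"
          by (simp add: ac_simps)
        also have "\<dots> \<le> open_content V + ennreal e"
          by (intro add_mono W_V order_refl)
        finally show ?thesis .
      qed
    qed
    moreover have "outer (U \<inter> A) \<le> open_content (U \<inter> V)"
      using V assms by (intro outer_le_open_content) auto
    ultimately show "outer (U \<inter> A) + outer (A - U) \<le> open_content V"
      by (rule order_trans[OF add_right_mono, rotated])
  qed
qed

definition riesz_measure :: "'a measure" where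
  "riesz_measure = measure_of UNIV (sets borel) outer"

lemma sets_riesz_measure: "sets riesz_measure = sets borel"
  unfolding riesz_measure_def by (metis sets.sigma_sets_eq sets_measure_of sets.space_closed space_borel)

lemma emeasure_riesz_measure:
  assumes "A \<in> sets borel"
  shows "emeasure riesz_measure A = outer A"
proof -
  interpret P: sigma_algebra UNIV "UNIV :: 'a set set"
    using sigma_algebra_Pow[of "UNIV :: 'a set"] by simp
  define \<Lambda> where "\<Lambda> = lambda_system UNIV UNIV outer"
  have "outer_measure_space UNIV outer"
    unfolding outer_measure_space_def positive_def increasing_def countably_subadditive_def
    using outer_empty outer_mono outer_Union by auto
  then have ms: "measure_space UNIV \<Lambda> outer"
    unfolding \<Lambda>_def by (rule P.caratheodory_lemma)
  then interpret \<Lambda>: sigma_algebra UNIV \<Lambda>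
    by (simp add: measure_space_def)
  have "U \<in> \<Lambda>" if "open U" for U
    unfolding \<Lambda>_def lambda_system_def using outer_split_open[OF that]
    by (simp add: Compl_eq_Diff_UNIV[symmetric] Int_commute Diff_eq)
  then have sub: "sets borel \<subseteq> \<Lambda>"
    unfolding borel_def by (subst sets_measure_of) (auto intro!: \<Lambda>.sigma_sets_subset)
  then have ca: "countably_additive (sets borel) outer"
    using ms unfolding measure_space_def countably_additive_def by (auto simp: subset_iff)
  have "sigma_algebra UNIV (sets borel :: 'a set set)"
    using sets.sigma_algebra_axioms[of "borel :: 'a measure"] by simp
  then show ?thesis
    unfolding riesz_measure_def using ca assms
    by (intro emeasure_measure_of_sigma) (auto simp: positive_def outer_empty)
qed

lemma riesz_measure_borel_probs: "riesz_measure \<in> borel_probs"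
proof -
  have "1 \<le> open_content UNIV"
    using open_content_upper[of "\<lambda>_. 1" UNIV] unit_functions_const[of 1] one by simp
  then have "open_content UNIV = 1"
    by (intro antisym open_content_le_1)
  then have "emeasure riesz_measure UNIV = 1"
    by (simp add: emeasure_riesz_measure outer_open)
  moreover have "space riesz_measure = UNIV"
    using sets_eq_imp_space_eq[OF sets_riesz_measure] by simp
  ultimately show ?thesis
    unfolding borel_probs_def using sets_riesz_measure by (auto intro: prob_spaceI)
qed

text \<open>Cut \<open>g\<close> into \<open>n\<close> horizontal slices of height \<open>1 / n\<close>. The \<open>j\<close>-th slice, stretched to height
  \<open>1\<close>, vanishes outside the open set \<open>{g > j / n}\<close>, so its value under \<open>L\<close> is at most the measure
  of that set; and the average of the indicators of these sets exceeds \<open>g\<close> by at most \<open>1 / n\<close>.\<close>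

lemma le_integral_riesz_measure:
  assumes g: "g \<in> unit_functions"
  shows "L g \<le> (\<integral>x. g x \<partial>riesz_measure)"
proof -
  interpret prob_space riesz_measure using borel_probsD(1)[OF riesz_measure_borel_probs] .
  note int = unit_functions_integrable[OF riesz_measure_borel_probs]
  have slice_sum: "(\<Sum>j<m. min (max (y - real j * c) 0) c) = min y (real m * c)"
    if "0 \<le> y" "0 \<le> c" for y c :: real and m
  proof (induction m)
    case (Suc m)
    have "min (max (y - real m * c) 0) c + min y (real m * c) = min y (real m * c + c)"
      using that by linarith
    then show ?case
      using Suc by (simp add: algebra_simps)
  qed (use that in simp)
  have count: "(\<Sum>j<n. indicator {x. real j < x} y) \<le> y + 1" if "0 \<le> y" for y :: real and n :: nat
  proof -
    have "(\<Sum>j<n. indicator {x. real j < x} y :: real) = real (card {j. j < n \<and> real j < y})"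
      by (simp add: indicator_def sum.If_cases Int_def lessThan_def)
    also have "card {j. j < n \<and> real j < y} \<le> card {..<nat \<lceil>y\<rceil>}"
      by (intro card_mono) (auto simp: less_ceiling_iff zless_nat_eq_int_zless)
    also have "real (card {..<nat \<lceil>y\<rceil>}) \<le> y + 1"
      using that by (simp, (linarith)?)
    finally show ?thesis by simp
  qed
  have "L g \<le> (\<integral>x. g x \<partial>riesz_measure) + 1 / Suc k" for k
  proof -
    define n where "n = Suc k"
    have n: "real n > 0" by (simp add: n_def)
    define s where "s j x = min (max (g x - real j * (1/n)) 0) (1/n)" for j x
    have s: "s j \<in> unit_functions" for j
      unfolding s_def[abs_def]
      by (intro unit_functions_min unit_functions_truncate g) auto
    have ns_le: "real n * s j x \<le> 1" for j x
    proof -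
      have "real n * s j x \<le> real n * (1/n)"
        using n by (intro mult_left_mono) (auto simp: s_def)
      then show ?thesis using n by simp
    qed
    have ns: "(\<lambda>x. real n * s j x) \<in> unit_functions" for j
      using ns_le unit_functionsD(1,2)[OF s] by (intro unit_functionsI continuous_intros) auto
    have open': "open {x. real j / n < g x}" for j
      using unit_functionsD(1)[OF g] by (intro open_Collect_less continuous_intros)
    have "ennreal (L (\<lambda>x. real n * s j x)) \<le> emeasure riesz_measure {x. real j / n < g x}" for j
      unfolding emeasure_riesz_measure[OF borel_open[OF open']] outer_open[OF open']
      by (intro open_content_upper ns) (auto simp: s_def)
    then have slice: "real n * L (s j) \<le> (\<integral>x. indicator {x. real j / n < g x} x \<partial>riesz_measure)" for j
      using scale[OF s ns_le] borel_open[OF open'] by (simp add: emeasure_eq_measure sets_riesz_measure)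
    have "g x = (\<Sum>j<n. s j x)" for x
      unfolding s_def using unit_functionsD(2,3)[OF g, of x] n by (subst slice_sum) auto
    then have "L g \<le> (\<Sum>j<n. L (s j))"
      by (intro le_sum s g) auto
    then have "real n * L g \<le> (\<Sum>j<n. real n * L (s j))"
      using n by (simp flip: sum_distrib_left)
    also have "\<dots> \<le> (\<Sum>j<n. \<integral>x. indicator {x. real j / n < g x} x \<partial>riesz_measure)"
      by (intro sum_mono slice)
    also have "\<dots> = (\<integral>x. (\<Sum>j<n. indicator {x. real j / n < g x} x) \<partial>riesz_measure)"
      using borel_open[OF open']
      by (intro Bochner_Integration.integral_sum[symmetric] integrable_real_indicator)
         (auto simp: sets_riesz_measure emeasure_eq_measure)
    also have "\<dots> \<le> (\<integral>x. real n * g x + 1 \<partial>riesz_measure)"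
    proof (rule integral_mono)
      show "integrable riesz_measure (\<lambda>x. \<Sum>j<n. indicator {x. real j / n < g x} x :: real)"
        using borel_open[OF open']
        by (intro Bochner_Integration.integrable_sum integrable_real_indicator)
           (auto simp: sets_riesz_measure emeasure_eq_measure)
      show "integrable riesz_measure (\<lambda>x. real n * g x + 1)"
        using int[OF g] by simp
      show "(\<Sum>j<n. indicator {x. real j / n < g x} x) \<le> real n * g x + 1" for x
        using count[of "real n * g x" n] unit_functionsD(2)[OF g, of x] n
        by (simp add: indicator_def field_simps)
    qed
    also have "\<dots> = real n * (\<integral>x. g x \<partial>riesz_measure) + 1"
      using int[OF g] by (simp add: prob_space)
    finally show ?thesis
      using n by (simp add: field_simps flip: n_def)
  qed
  moreover have "(\<lambda>k. (\<integral>x. g x \<partial>riesz_measure) + 1 / Suc k) \<longlonglongrightarrow> (\<integral>x. g x \<partial>riesz_measure) + 0"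
    by (intro tendsto_intros LIMSEQ_Suc[OF lim_1_over_n])
  ultimately show ?thesis
    using LIMSEQ_le_const[of "\<lambda>k. (\<integral>x. g x \<partial>riesz_measure) + 1 / Suc k"] by auto
qed

text \<open>The reverse inequality is the previous lemma applied to \<open>1 - g\<close>.\<close>

theorem integral_riesz_measure:
  assumes g: "g \<in> unit_functions"
  shows "(\<integral>x. g x \<partial>riesz_measure) = L g"
proof (rule antisym)
  interpret prob_space riesz_measure using borel_probsD(1)[OF riesz_measure_borel_probs] .
  have 1: "(\<lambda>_. 1 :: real) \<in> unit_functions" by (simp add: unit_functions_const)
  have "1 - L g = L (\<lambda>x. 1 - g x)"
    using diff[OF g 1] unit_functionsD(3)[OF g] one by simp
  also have "\<dots> \<le> (\<integral>x. 1 - g x \<partial>riesz_measure)"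
    using unit_functions_diff[OF g 1] unit_functionsD(3)[OF g] by (intro le_integral_riesz_measure) auto
  also have "\<dots> = 1 - (\<integral>x. g x \<partial>riesz_measure)"
    using unit_functions_integrable[OF riesz_measure_borel_probs g] by (simp add: prob_space)
  finally show "(\<integral>x. g x \<partial>riesz_measure) \<le> L g" by simp
qed (rule le_integral_riesz_measure[OF g])

end

section \<open>Compactness of tight families\<close>

lemma closedin_weak_integral:
  fixes g :: "'a::topological_space \<Rightarrow> real"
  assumes "continuous_on UNIV g" "bounded (range g)" "closed F"
  shows "closedin weak_topology {\<mu> \<in> borel_probs. (\<integral>x. g x \<partial>\<mu>) \<in> F}"
proof -
  have "openin weak_topology {\<mu> \<in> borel_probs. (\<integral>x. g x \<partial>\<mu>) \<in> - F}"
    unfolding weak_topology_def using assms by (intro topology_generated_by_Basis) blast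
  moreover have "borel_probs - {\<mu> \<in> borel_probs. (\<integral>x. g x \<partial>\<mu>) \<in> F} = {\<mu> \<in> borel_probs. (\<integral>x. g x \<partial>\<mu>) \<in> - F}"
    by auto
  ultimately show ?thesis
    by (auto simp: closedin_def)
qed

lemma continuous_map_weak_topologyI:
  fixes \<Phi> :: "'b \<Rightarrow> 'a::topological_space measure"
  assumes into: "\<And>x. x \<in> topspace T \<Longrightarrow> \<Phi> x \<in> borel_probs"
    and cont: "\<And>g :: 'a \<Rightarrow> real. continuous_on UNIV g \<Longrightarrow> bounded (range g) \<Longrightarrow>
      continuous_map T euclideanreal (\<lambda>x. \<integral>y. g y \<partial>\<Phi> x)"
  shows "continuous_map T weak_topology \<Phi>"
  unfolding weak_topology_def
proof (rule continuous_on_generated_topo)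
  show "\<Phi> ` topspace T \<subseteq> \<Union> {{\<mu> \<in> borel_probs. (\<integral>x. g x \<partial>\<mu>) \<in> U} | (g :: 'a \<Rightarrow> real) U.
      continuous_on UNIV g \<and> bounded (range g) \<and> open U}"
    using into topspace_weak_topology
    unfolding weak_topology_def topology_generated_by_topspace by blast
  fix U
  assume "U \<in> {{\<mu> \<in> borel_probs. (\<integral>x. g x \<partial>\<mu>) \<in> U} | (g :: 'a \<Rightarrow> real) U.
      continuous_on UNIV g \<and> bounded (range g) \<and> open U}"
  then obtain g :: "'a \<Rightarrow> real" and V where U: "U = {\<mu> \<in> borel_probs. (\<integral>x. g x \<partial>\<mu>) \<in> V}"
    and g: "continuous_on UNIV g" "bounded (range g)" and V: "open V"
    by blast
  have "openin T {x \<in> topspace T. (\<integral>y. g y \<partial>\<Phi> x) \<in> V}"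
    using cont[OF g] V by (auto intro: openin_continuous_map_preimage)
  moreover have "\<Phi> -` U \<inter> topspace T = {x \<in> topspace T. (\<integral>y. g y \<partial>\<Phi> x) \<in> V}"
    using into by (auto simp: U)
  ultimately show "openin T (\<Phi> -` U \<inter> topspace T)"
    by simp
qed

lemma bounded_continuous_affine:
  fixes g :: "'a::topological_space \<Rightarrow> real"
  assumes "continuous_on UNIV g" "bounded (range g)"
  obtains h a b where "h \<in> unit_functions" "g = (\<lambda>x. a * h x + b)"
proof -
  obtain B where B: "0 < B" "\<And>x. \<bar>g x\<bar> \<le> B"
    using assms(2) by (auto simp: bounded_pos)
  \<comment> \<open>maps \<open>[- B, B]\<close> onto \<open>[0, 1]\<close>\<close>
  define h where "h x = (g x + B) / (2 * B)" for x
  have "h \<in> unit_functions"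
    unfolding h_def[abs_def]
  proof (intro unit_functionsI continuous_intros assms)
    show "0 \<le> (g x + B) / (2 * B)" "(g x + B) / (2 * B) \<le> 1" for x
      using B(1) B(2)[of x] by (auto simp: field_simps abs_le_iff)
  qed (use B in auto)
  moreover have "g = (\<lambda>x. (2 * B) * h x + (- B))"
    using B by (auto simp: h_def)
  ultimately show ?thesis
    using that by blast
qed

text \<open>The conditions in \<open>tight_functional\<close> leave the values at functions outside \<open>unit_functions\<close> free;
  confining these to \<open>[0, 1]\<close> too gives a closed subset of a full product of compact intervals.\<close>

lemma compact_tight_functionals:
  assumes "\<And>n. compact (K n)"
  shows "compact {L. (\<forall>g. L g \<in> {0..1}) \<and> tight_functional L K}"
proof -
  have eval: "continuous_on UNIV (\<lambda>L :: ('a \<Rightarrow> real) \<Rightarrow> real. L g)" for g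
    by (rule continuous_on_product_coordinates)
  have "closed {L. tight_functional L K}"
    unfolding tight_functional_def using assms
    by (intro closed_Collect_conj closed_Collect_all closed_Collect_imp open_Collect_const
        closed_Collect_const closed_Collect_le closed_Collect_eq continuous_intros eval)
  moreover have "compact (PiE UNIV (\<lambda>_ :: 'a \<Rightarrow> real. {0..1 :: real}))"
    using compactin_PiE[of "\<lambda>_ :: 'a \<Rightarrow> real. euclideanreal" UNIV "\<lambda>_. {0..1}"]
    by (simp add: euclidean_product_topology)
  ultimately have "compact (PiE UNIV (\<lambda>_ :: 'a \<Rightarrow> real. {0..1 :: real}) \<inter> {L. tight_functional L K})"
    by (rule compact_Int_closed[rotated])
  moreover have "PiE UNIV (\<lambda>_ :: 'a \<Rightarrow> real. {0..1 :: real}) \<inter> {L. tight_functional L K}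
    = {L. (\<forall>g. L g \<in> {0..1}) \<and> tight_functional L K}"
    by (auto simp: PiE_def Pi_def)
  ultimately show ?thesis by simp
qed

lemma tight_functional_integral:
  fixes \<mu> :: "'a::metric_space measure"
  assumes mu: "\<mu> \<in> borel_probs" and K: "\<And>n. compact (K n)"
    and tight: "\<And>n. measure \<mu> (- K n) \<le> 1 / Suc n"
  shows "tight_functional (\<lambda>g. if g \<in> unit_functions then \<integral>x. g x \<partial>\<mu> else 0) K"
proof -
  interpret prob_space \<mu> using borel_probsD(1)[OF mu] .
  note int = unit_functions_integrable[OF mu]
  have "(\<integral>x. g x \<partial>\<mu>) \<le> 1 / Suc n"
    if g: "g \<in> unit_functions" and "\<And>x. x \<in> K n \<Longrightarrow> g x = 0" for g n
  proof -
    have KC: "- K n \<in> sets \<mu>"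
      using compact_imp_closed[OF K] borel_probsD(2)[OF mu] by auto
    have "(\<integral>x. g x \<partial>\<mu>) \<le> (\<integral>x. indicator (- K n) x \<partial>\<mu>)"
      using that unit_functionsD(3)[OF g] KC
      by (intro integral_mono int integrable_real_indicator)
         (auto simp: indicator_def emeasure_eq_measure)
    also have "\<dots> \<le> 1 / Suc n"
      using tight[of n] KC by simp
    finally show ?thesis .
  qed
  then show ?thesis
    using K int unit_functionsD(2)
    by unfold_locales (auto simp: prob_space unit_functions_const intro!: Bochner_Integration.integral_nonneg)
qed

text \<open>The nontrivial direction of Prokhorov's theorem, for closed sets. The set \<open>M\<close> is contained in the
  image of the compact set of tight functionals under the map to the representing measure. That map
  is continuous because the integral of a fixed bounded continuous function is, up to an affine
  change, an evaluation of the functional.\<close>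

theorem tight_closedin_imp_compactin_weak:
  fixes M :: "'a::metric_space measure set"
  assumes closed: "closedin weak_topology M"
    and tight: "\<And>e. 0 < e \<Longrightarrow> \<exists>K. compact K \<and> (\<forall>\<mu>\<in>M. measure \<mu> (- K) \<le> e)"
  shows "compactin weak_topology M"
proof -
  have "\<exists>K. compact K \<and> (\<forall>\<mu>\<in>M. measure \<mu> (- K) \<le> 1 / real (Suc n))" for n
    by (rule tight) simp
  then obtain K where K: "\<And>n. compact (K n)"
    and KM: "\<And>n \<mu>. \<mu> \<in> M \<Longrightarrow> measure \<mu> (- K n) \<le> 1 / real (Suc n)"
    by metis
  define S where "S = {L :: ('a \<Rightarrow> real) \<Rightarrow> real. (\<forall>g. L g \<in> {0..1}) \<and> tight_functional L K}"
  have "compactin (top_of_set S) S"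
    using compact_tight_functionals[OF K] unfolding S_def by simp
  moreover have "continuous_map (top_of_set S) weak_topology tight_functional.riesz_measure"
  proof (rule continuous_map_weak_topologyI)
    show "tight_functional.riesz_measure L \<in> borel_probs" if "L \<in> topspace (top_of_set S)" for L
      using that by (auto simp: S_def intro: tight_functional.riesz_measure_borel_probs)
    fix g :: "'a \<Rightarrow> real"
    assume "continuous_on UNIV g" "bounded (range g)"
    then obtain h a b where h: "h \<in> unit_functions" and g: "g = (\<lambda>x. a * h x + b)"
      by (rule bounded_continuous_affine)
    have eq: "a * L h + b = (\<integral>x. g x \<partial>tight_functional.riesz_measure L)" if "L \<in> S" for L
    proof -
      interpret tight_functional L K using that by (simp add: S_def)
      interpret prob_space riesz_measure using borel_probsD(1)[OF riesz_measure_borel_probs] .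
      show ?thesis
        using unit_functions_integrable[OF riesz_measure_borel_probs h] integral_riesz_measure[OF h]
        by (simp add: g prob_space)
    qed
    have "continuous_on S (\<lambda>L :: ('a \<Rightarrow> real) \<Rightarrow> real. a * L h + b)"
      by (intro continuous_intros continuous_on_subset[OF continuous_on_product_coordinates]) auto
    then have "continuous_on S (\<lambda>L. \<integral>x. g x \<partial>tight_functional.riesz_measure L)"
      using eq by (simp cong: continuous_on_cong)
    then show "continuous_map (top_of_set S) euclideanreal (\<lambda>L. \<integral>x. g x \<partial>tight_functional.riesz_measure L)"
      by simp
  qed
  ultimately have "compactin weak_topology (tight_functional.riesz_measure ` S)"
    by (rule image_compactin)
  moreover have "M \<subseteq> tight_functional.riesz_measure ` S"
  proof
    fix \<mu> assume "\<mu> \<in> M"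
    then have mu: "\<mu> \<in> borel_probs"
      using closedin_subset[OF closed] by auto
    define L where "L g = (if g \<in> unit_functions then \<integral>x. g x \<partial>\<mu> else 0)" for g
    interpret tight_functional L K
      unfolding L_def[abs_def] by (rule tight_functional_integral[OF mu K KM[OF \<open>\<mu> \<in> M\<close>]])
    have "L g \<in> {0..1}" for g
      using nonneg[of g] le_one[of g] by (cases "g \<in> unit_functions") (auto simp: L_def)
    then have "L \<in> S"
      using tight_functional_axioms by (simp add: S_def)
    moreover have "\<mu> = riesz_measure"
      using mu riesz_measure_borel_probs by (rule borel_probs_eqI) (simp add: integral_riesz_measure L_def)
    ultimately show "\<mu> \<in> tight_functional.riesz_measure ` S" by blast
  qed
  ultimately show ?thesis
    using closed by (rule closed_compactin)
qed

section \<open>Transport plans\<close>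

lemma continuous_distr:
  fixes f :: "'a::topological_space \<Rightarrow> 'b::topological_space"
  assumes f: "continuous_on UNIV f" and g: "\<gamma> \<in> borel_probs"
  shows distr_borel_probs: "distr \<gamma> borel f \<in> borel_probs"
    and integral_distr_continuous: "continuous_on UNIV h \<Longrightarrow>
      (\<integral>y. h y \<partial>distr \<gamma> borel f) = (\<integral>x. (h (f x) :: real) \<partial>\<gamma>)"
proof -
  have meas: "f \<in> measurable \<gamma> borel"
    using borel_measurable_continuous_onI[OF f] borel_probsD(2)[OF g]
    by (simp cong: measurable_cong_sets)
  then show "distr \<gamma> borel f \<in> borel_probs"
    using borel_probsD(1)[OF g] by (simp add: borel_probs_def prob_space.prob_space_distr)
  show "(\<integral>y. h y \<partial>distr \<gamma> borel f) = (\<integral>x. (h (f x) :: real) \<partial>\<gamma>)" if "continuous_on UNIV h"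
    using meas that by (intro integral_distr borel_measurable_continuous_onI)
qed

lemma continuous_map_distr:
  fixes f :: "'a::topological_space \<Rightarrow> 'b::topological_space"
  assumes f: "continuous_on UNIV f"
  shows "continuous_map weak_topology weak_topology (\<lambda>\<gamma>. distr \<gamma> borel f)"
proof (rule continuous_map_weak_topologyI)
  show "distr \<gamma> borel f \<in> borel_probs" if "\<gamma> \<in> topspace weak_topology" for \<gamma>
    using that distr_borel_probs[OF f] by simp
  fix g :: "'b \<Rightarrow> real"
  assume g: "continuous_on UNIV g" "bounded (range g)"
  have gf: "continuous_on UNIV (\<lambda>x. g (f x))" "bounded (range (\<lambda>x. g (f x)))"
    using continuous_on_compose2[OF g(1) f] bounded_subset[OF g(2), of "range (\<lambda>x. g (f x))"] by auto
  have "continuous_map weak_topology euclideanreal (\<lambda>\<gamma>. \<integral>x. g (f x) \<partial>\<gamma>)"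
    unfolding continuous_map_closedin
    using closedin_weak_integral[OF gf] by auto
  then show "continuous_map weak_topology euclideanreal (\<lambda>\<gamma>. \<integral>y. g y \<partial>distr \<gamma> borel f)"
    by (rule continuous_map_eq) (simp add: integral_distr_continuous[OF f _ g(1)])
qed

lemma closedin_weak_marginal:
  fixes f :: "'a::topological_space \<Rightarrow> 'b::metric_space"
  assumes f: "continuous_on UNIV f" and nu: "\<nu> \<in> borel_probs"
  shows "closedin weak_topology {\<gamma> \<in> borel_probs. distr \<gamma> borel f = \<nu>}"
proof -
  have "{\<gamma> \<in> borel_probs. distr \<gamma> borel f = \<nu>} =
    (\<Inter>g\<in>unit_functions. {\<gamma> \<in> borel_probs. (\<integral>x. g (f x) \<partial>\<gamma>) \<in> {\<integral>y. g y \<partial>\<nu>}})" (is "?l = ?r")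
  proof (intro set_eqI iffI)
    fix \<gamma> assume "\<gamma> \<in> ?l"
    then show "\<gamma> \<in> ?r"
      by (auto simp: integral_distr_continuous[OF f] unit_functionsD(1))
  next
    fix \<gamma> assume r: "\<gamma> \<in> ?r"
    then have g: "\<gamma> \<in> borel_probs"
      using unit_functions_const[of 0] by auto
    have "distr \<gamma> borel f = \<nu>"
      using distr_borel_probs[OF f g] nu
    proof (rule borel_probs_eqI)
      show "(\<integral>y. h y \<partial>distr \<gamma> borel f) = (\<integral>y. h y \<partial>\<nu>)" if "h \<in> unit_functions" for h
        using integral_distr_continuous[OF f g unit_functionsD(1)[OF that]] r that by auto
    qed
    then show "\<gamma> \<in> ?l" using g by simp
  qed
  moreover have "closedin weak_topology {\<gamma> \<in> borel_probs. (\<integral>x. g (f x) \<partial>\<gamma>) \<in> {\<integral>y. g y \<partial>\<nu>}}"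
    if "g \<in> unit_functions" for g
    using continuous_on_compose2[OF unit_functionsD(1)[OF that] f]
      bounded_subset[OF unit_functions_bounded[OF that], of "range (\<lambda>x. g (f x))"]
    by (intro closedin_weak_integral) auto
  moreover have "unit_functions \<noteq> ({} :: ('b \<Rightarrow> real) set)"
    using unit_functions_const[of 0] by auto
  ultimately show ?thesis
    by (simp only:) (rule closedin_INT)
qed

text \<open>Lower semicontinuity of the integral of a nonnegative continuous function: by monotone convergence,
  the bound is equivalent to the same bound for all truncations \<open>min (c x) n\<close>, whose integrals are
  weakly continuous.\<close>

lemma closedin_weak_nn_integral_le:
  fixes c :: "'a::topological_space \<Rightarrow> real"
  assumes c: "continuous_on UNIV c" "\<And>x. 0 \<le> c x" and s: "0 \<le> s"
  shows "closedin weak_topology {\<gamma> \<in> borel_probs. (\<integral>\<^sup>+x. ennreal (c x) \<partial>\<gamma>) \<le> ennreal s}"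
proof -
  define t where "t n x = min (c x) (real n)" for n x
  have t: "continuous_on UNIV (t n)" "bounded (range (t n))" "0 \<le> t n x" for n x
    using c unfolding t_def[abs_def]
    by (auto intro!: continuous_intros boundedI[where B="real n"])
  have "{\<gamma> \<in> borel_probs. (\<integral>\<^sup>+x. ennreal (c x) \<partial>\<gamma>) \<le> ennreal s} =
    (\<Inter>n. {\<gamma> \<in> borel_probs. (\<integral>x. t n x \<partial>\<gamma>) \<in> {..s}})"
  proof -
    have "(\<integral>\<^sup>+x. ennreal (c x) \<partial>\<gamma>) \<le> ennreal s \<longleftrightarrow> (\<forall>n. (\<integral>x. t n x \<partial>\<gamma>) \<le> s)"
      if g: "\<gamma> \<in> borel_probs" for \<gamma>
    proof -
      have "(\<integral>\<^sup>+x. ennreal (c x) \<partial>\<gamma>) = (\<integral>\<^sup>+x. (SUP n. ennreal (t n x)) \<partial>\<gamma>)"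
      proof (intro nn_integral_cong antisym)
        fix x
        obtain n where "c x \<le> real n" using real_arch_simple by blast
        then show "ennreal (c x) \<le> (SUP n. ennreal (t n x))"
          by (intro SUP_upper2[of n]) (auto simp: t_def)
        show "(SUP n. ennreal (t n x)) \<le> ennreal (c x)"
          by (intro SUP_least ennreal_leI) (simp add: t_def)
      qed
      also have "\<dots> = (SUP n. \<integral>\<^sup>+x. ennreal (t n x) \<partial>\<gamma>)"
      proof (rule nn_integral_monotone_convergence_SUP)
        show "incseq (\<lambda>n x. ennreal (t n x))"
          by (intro incseq_SucI le_funI ennreal_leI) (auto simp: t_def)
        show "(\<lambda>x. ennreal (t n x)) \<in> borel_measurable \<gamma>" for n
          using continuous_borel_probs_measurable[OF g t(1)] by simp
      qed
      also have "\<dots> = (SUP n. ennreal (\<integral>x. t n x \<partial>\<gamma>))"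
        using bounded_continuous_integrable[OF g t(1,2)] t(3)
        by (simp add: nn_integral_eq_integral)
      finally show ?thesis
        using s by (simp add: SUP_le_iff)
    qed
    then show ?thesis by auto
  qed
  also have "closedin weak_topology \<dots>"
    by (intro closedin_INT closedin_weak_integral t) auto
  finally show ?thesis .
qed

text \<open>The bound \<open>s\<close> is on the cost itself, before the root is taken, and the first marginal is left
  free.\<close>

definition plans :: "real \<Rightarrow> real \<Rightarrow> 'a::polish_space measure \<Rightarrow> ('a \<times> 'a) measure set" where
  "plans p s \<nu> = {\<gamma> \<in> borel_probs. distr \<gamma> borel snd = \<nu> \<and>
     (\<integral>\<^sup>+ z. ennreal (dist (fst z) (snd z) powr p) \<partial>\<gamma>) \<le> ennreal s}"

lemma closedin_plans:
  assumes "0 < p" "0 \<le> s" "\<nu> \<in> borel_probs"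
  shows "closedin weak_topology (plans p s \<nu>)"
proof -
  have "closedin weak_topology ({\<gamma> \<in> borel_probs. distr \<gamma> borel snd = \<nu>} \<inter>
    {\<gamma> \<in> borel_probs. (\<integral>\<^sup>+ z. ennreal (dist (fst z) (snd z) powr p) \<partial>\<gamma>) \<le> ennreal s})"
    using assms
    by (intro closedin_Int closedin_weak_marginal closedin_weak_nn_integral_le
        continuous_on_powr' continuous_intros) auto
  also have "\<dots> = plans p s \<nu>"
    by (auto simp: plans_def)
  finally show ?thesis .
qed

lemma borel_prob_tail:
  fixes \<nu> :: "'a::metric_space measure"
  assumes nu: "\<nu> \<in> borel_probs" and "0 < e"
  shows "\<exists>R. \<forall>R'\<ge>R. measure \<nu> (- cball x\<^sub>0 R') \<le> e"
proof -
  interpret prob_space \<nu> using borel_probsD(1)[OF nu] .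
  have meas: "- cball x\<^sub>0 R \<in> sets \<nu>" for R
    using borel_probsD(2)[OF nu] by auto
  have "(\<lambda>n. measure \<nu> (- cball x\<^sub>0 (real n))) \<longlonglongrightarrow> measure \<nu> (\<Inter>n. - cball x\<^sub>0 (real n))"
    using meas by (intro finite_Lim_measure_decseq) (auto simp: decseq_def)
  moreover have "(\<Inter>n. - cball x\<^sub>0 (real n)) = {}"
    by (simp add: set_eq_iff real_arch_simple)
  ultimately have "\<forall>\<^sub>F n in sequentially. measure \<nu> (- cball x\<^sub>0 (real n)) < e"
    using \<open>0 < e\<close> by (intro order_tendstoD(2)[of _ 0]) auto
  then obtain n where n: "measure \<nu> (- cball x\<^sub>0 (real n)) < e"
    using eventually_happens by fastforce
  have "measure \<nu> (- cball x\<^sub>0 R) \<le> e" if "real n \<le> R" for R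
  proof -
    have "measure \<nu> (- cball x\<^sub>0 R) \<le> measure \<nu> (- cball x\<^sub>0 (real n))"
      using that by (intro finite_measure_mono meas) auto
    then show ?thesis using n by simp
  qed
  then show ?thesis by blast
qed

text \<open>If \<open>d (y, x\<^sub>0) \<le> R\<close> and \<open>d (x, y) < R\<close>, then \<open>(x, y)\<close> lies in the compact set
  \<open>cball x\<^sub>0 (2 * R) \<times> cball x\<^sub>0 R\<close>. The probability that the first condition fails depends on \<open>\<nu>\<close> only, the
  one that the second fails is at most \<open>s / R powr p\<close> by Markov's inequality.\<close>

lemma plans_tight:
  fixes \<nu> :: "'a::polish_space measure"
  assumes proper: "\<And>(x\<^sub>0::'a) R. 0 < R \<Longrightarrow> compact (cball x\<^sub>0 R)"
    and "1 \<le> p" "0 \<le> s" and nu: "\<nu> \<in> borel_probs" and e: "0 < e"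
  shows "\<exists>K. compact K \<and> (\<forall>\<gamma>\<in>plans p s \<nu>. measure \<gamma> (- K) \<le> e)"
proof -
  obtain x\<^sub>0 :: 'a where True by simp
  obtain R\<^sub>0 where R\<^sub>0: "\<And>R. R\<^sub>0 \<le> R \<Longrightarrow> measure \<nu> (- cball x\<^sub>0 R) \<le> e / 2"
    using borel_prob_tail[OF nu, of "e / 2"] e by auto
  \<comment> \<open>as \<open>p \<ge> 1\<close>, the bound \<open>R \<ge> 1\<close> gives \<open>R powr p \<ge> R\<close>, so \<open>R \<ge> 2 * s / e\<close> suffices for Markov's inequality\<close>
  define R where "R = max R\<^sub>0 (max 1 (2 * s / e))"
  have R: "R\<^sub>0 \<le> R" "1 \<le> R" "2 * s / e \<le> R"
    by (auto simp: R_def)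
  have Rp: "R \<le> R powr p"
    using powr_mono[of 1 p R] R \<open>1 \<le> p\<close> by simp
  have "s / R powr p \<le> e / 2"
  proof -
    have "2 * s \<le> e * R" using R(3) e by (simp add: field_simps)
    also have "\<dots> \<le> e * R powr p" using Rp e by simp
    finally show ?thesis using R by (simp add: field_simps)
  qed
  define K where "K = cball x\<^sub>0 (2 * R) \<times> cball x\<^sub>0 R"
  have "compact K"
    unfolding K_def using R by (intro compact_Times proper) auto
  moreover have "measure \<gamma> (- K) \<le> e" if "\<gamma> \<in> plans p s \<nu>" for \<gamma>
  proof -
    from that have \<gamma>: "\<gamma> \<in> borel_probs" and snd: "distr \<gamma> borel snd = \<nu>"
      and cost: "(\<integral>\<^sup>+ z. ennreal (dist (fst z) (snd z) powr p) \<partial>\<gamma>) \<le> ennreal s"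
      by (auto simp: plans_def)
    interpret prob_space \<gamma> using borel_probsD(1)[OF \<gamma>] .
    note sets = borel_probsD(2)[OF \<gamma>] and space = borel_probsD(3)[OF \<gamma>]
    define A where "A = {z :: 'a \<times> 'a. R \<le> dist (fst z) (snd z)}"
    define B :: "('a \<times> 'a) set" where "B = snd -` (- cball x\<^sub>0 R)"
    have "closed A"
      unfolding A_def by (intro closed_Collect_le continuous_intros)
    then have A: "A \<in> sets \<gamma>" by (simp add: sets)
    have "open B"
      unfolding B_def by (intro open_vimage_snd) auto
    then have B: "B \<in> sets \<gamma>" by (simp add: sets)
    have "- K \<subseteq> A \<union> B"
    proof (intro subsetI, rule ccontr)
      fix z assume "z \<in> - K" "z \<notin> A \<union> B"
      moreover have "dist x\<^sub>0 (fst z) \<le> dist x\<^sub>0 (snd z) + dist (fst z) (snd z)"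
        by (metis dist_commute dist_triangle)
      ultimately show False
        by (cases z) (auto simp: K_def A_def B_def)
    qed
    then have "measure \<gamma> (- K) \<le> measure \<gamma> (A \<union> B)"
      using A B by (intro finite_measure_mono) auto
    also have "\<dots> \<le> measure \<gamma> A + measure \<gamma> B"
      by (intro measure_subadditive A B) auto
    also have "measure \<gamma> A \<le> e / 2"
    proof -
      have cost_meas: "(\<lambda>z. ennreal (dist (fst z) (snd z) powr p)) \<in> borel_measurable \<gamma>"
        using \<open>1 \<le> p\<close>
        by (intro measurable_compose[OF _ measurable_ennreal] continuous_borel_probs_measurable[OF \<gamma>]
            continuous_on_powr' continuous_intros) auto
      have "A \<subseteq> {z \<in> space \<gamma>. 1 \<le> ennreal (1 / R powr p) * ennreal (dist (fst z) (snd z) powr p)}"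
      proof
        fix z assume "z \<in> A"
        then have "R powr p \<le> dist (fst z) (snd z) powr p"
          using R \<open>1 \<le> p\<close> by (auto simp: A_def intro!: powr_mono2)
        then have "1 \<le> (1 / R powr p) * dist (fst z) (snd z) powr p"
          using R by (simp add: field_simps)
        then show "z \<in> {z \<in> space \<gamma>. 1 \<le> ennreal (1 / R powr p) * ennreal (dist (fst z) (snd z) powr p)}"
          by (simp add: space flip: ennreal_mult)
      qed
      then have "emeasure \<gamma> A \<le> emeasure \<gamma> {z \<in> space \<gamma>. 1 \<le> ennreal (1 / R powr p) * ennreal (dist (fst z) (snd z) powr p)}"
        using cost_meas by (intro emeasure_mono) auto
      also have "\<dots> \<le> ennreal (1 / R powr p) *
          (\<integral>\<^sup>+ z. ennreal (dist (fst z) (snd z) powr p) * indicator (space \<gamma>) z \<partial>\<gamma>)"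
        using cost_meas by (intro nn_integral_Markov_inequality) auto
      also have "\<dots> \<le> ennreal (1 / R powr p) * ennreal s"
        using cost by (intro mult_left_mono) (auto simp: space)
      also have "\<dots> = ennreal (s / R powr p)"
        using \<open>0 \<le> s\<close> by (simp flip: ennreal_mult)
      also have "\<dots> \<le> ennreal (e / 2)"
        using \<open>s / R powr p \<le> e / 2\<close> by (rule ennreal_leI)
      finally show ?thesis
        using e by (simp add: emeasure_eq_measure)
    qed
    also have "measure \<gamma> B = measure \<nu> (- cball x\<^sub>0 R)"
    proof -
      have "snd \<in> measurable \<gamma> borel"
        using borel_measurable_continuous_onI[of "snd :: 'a \<times> 'a \<Rightarrow> 'a"] sets
        by (simp add: continuous_on_snd cong: measurable_cong_sets)
      then show ?thesis
        by (simp add: B_def space measure_distr flip: snd)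
    qed
    also have "\<dots> \<le> e / 2"
      by (intro R\<^sub>0 R)
    finally show ?thesis by simp
  qed
  ultimately show ?thesis by blast
qed

lemma compactin_plans:
  fixes \<nu> :: "'a::polish_space measure"
  assumes "\<And>(x\<^sub>0::'a) R. 0 < R \<Longrightarrow> compact (cball x\<^sub>0 R)"
    and "1 \<le> p" "0 \<le> s" "\<nu> \<in> borel_probs"
  shows "compactin weak_topology (plans p s \<nu>)"
  using assms
  by (intro tight_closedin_imp_compactin_weak closedin_plans plans_tight) auto

lemma ennreal_powr_leI:
  assumes "0 < p" "0 \<le> r" "x \<le> ennreal (r powr p)"
  shows "ennreal_powr x (1 / p) \<le> ennreal r"
proof -
  obtain y where y: "x = ennreal y" "0 \<le> y"
    using assms(3) by (cases x) (auto simp: top_unique)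
  then have "y \<le> r powr p"
    using assms by simp
  then have "y powr (1 / p) \<le> (r powr p) powr (1 / p)"
    using assms y by (intro powr_mono2) auto
  then show ?thesis
    using assms y by (simp add: ennreal_powr_def powr_powr ennreal_leI)
qed

lemma ennreal_powr_less_imp:
  assumes "0 < p" "0 \<le> t" "ennreal_powr x (1 / p) < ennreal (t powr (1 / p))"
  shows "x \<le> ennreal t"
proof -
  obtain y where y: "x = ennreal y" "0 \<le> y"
    using assms(3) by (cases x) (auto simp: ennreal_powr_def)
  then have "y powr (1 / p) < t powr (1 / p)"
    using assms by (simp add: ennreal_powr_def ennreal_less_iff)
  then have "(y powr (1 / p)) powr p \<le> (t powr (1 / p)) powr p"
    using assms(1) by (simp add: powr_mono2 del: powr_powr)
  then show ?thesis
    using assms y by (simp add: powr_powr ennreal_leI)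
qed

text \<open>The infimum in the Wasserstein distance is attained: the plans between \<open>\<mu>\<close> and \<open>\<nu>\<close> whose cost is
  at most \<open>r powr p + 1 / Suc n\<close> form a decreasing sequence of nonempty compact sets.\<close>

theorem wasserstein_le_iff_plan:
  fixes \<mu> \<nu> :: "'a::polish_space measure"
  assumes proper: "\<And>(x\<^sub>0::'a) R. 0 < R \<Longrightarrow> compact (cball x\<^sub>0 R)"
    and p: "1 \<le> p" and r: "0 \<le> r" and mu: "\<mu> \<in> borel_probs" and nu: "\<nu> \<in> borel_probs"
  shows "wasserstein p \<mu> \<nu> \<le> ennreal r \<longleftrightarrow>
    (\<exists>\<gamma>\<in>plans p (r powr p) \<nu>. distr \<gamma> borel fst = \<mu>)"
proof
  assume "\<exists>\<gamma>\<in>plans p (r powr p) \<nu>. distr \<gamma> borel fst = \<mu>"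
  then obtain \<gamma> where "\<gamma> \<in> couplings \<mu> \<nu>"
    and "(\<integral>\<^sup>+ z. ennreal (dist (fst z) (snd z) powr p) \<partial>\<gamma>) \<le> ennreal (r powr p)"
    by (auto simp: plans_def couplings_def)
  then show "wasserstein p \<mu> \<nu> \<le> ennreal r"
    unfolding wasserstein_def using p r by (intro INF_lower2 ennreal_powr_leI) auto
next
  assume W: "wasserstein p \<mu> \<nu> \<le> ennreal r"
  define s where "s n = r powr p + 1 / real (Suc n)" for n
  have s: "0 \<le> s n" for n by (simp add: s_def)
  define D where "D n = {\<gamma> \<in> borel_probs. distr \<gamma> borel fst = \<mu>} \<inter> plans p (s n) \<nu>" for n
  have fst: "continuous_on UNIV (fst :: 'a \<times> 'a \<Rightarrow> 'a)"
    by (intro continuous_intros)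
  have closed: "closedin weak_topology (D n)" for n
    unfolding D_def using p s nu
    by (intro closedin_Int closedin_weak_marginal fst mu closedin_plans) auto
  have dec: "D m \<subseteq> D n" if "n \<le> m" for m n
  proof -
    have "s m \<le> s n"
      using that by (simp add: s_def frac_le)
    then show ?thesis
      by (auto simp: D_def plans_def intro: order_trans[OF _ ennreal_leI])
  qed
  have "compactin weak_topology (plans p (s 0) \<nu>)"
    by (intro compactin_plans proper p s nu)
  then have "compactin weak_topology (D 0)"
    by (rule closed_compactin[OF _ _ closed]) (auto simp: D_def)
  then have "compact_space (subtopology weak_topology (D 0))"
    by (rule compact_space_subtopology)
  moreover have "closedin (subtopology weak_topology (D 0)) (D n)" for n
    using closed dec[of 0 n] by (auto intro: closedin_subset_topspace)
  moreover have "D n \<noteq> {}" for n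
  proof -
    have "r = (r powr p) powr (1 / p)"
      using p r by (simp add: powr_powr)
    also have "\<dots> < s n powr (1 / p)"
      using p by (intro powr_less_mono2) (auto simp: s_def)
    finally have "wasserstein p \<mu> \<nu> < ennreal (s n powr (1 / p))"
      using order_le_less_trans[OF W] r by (simp add: ennreal_less_iff)
    then obtain \<gamma> where "\<gamma> \<in> couplings \<mu> \<nu>" and
      "ennreal_powr (\<integral>\<^sup>+ z. ennreal (dist (fst z) (snd z) powr p) \<partial>\<gamma>) (1 / p) < ennreal (s n powr (1 / p))"
      unfolding wasserstein_def by (auto simp: INF_less_iff)
    then have "\<gamma> \<in> D n"
      using p s ennreal_powr_less_imp[of p "s n"] by (auto simp: D_def plans_def couplings_def)
    then show ?thesis by blast
  qed
  moreover have "decseq D"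
    using dec by (auto simp: decseq_def)
  ultimately have "(\<Inter>n. D n) \<noteq> {}"
    by (rule compact_space_imp_nest)
  then obtain \<gamma> where \<gamma>: "\<And>n. \<gamma> \<in> D n" by blast
  have "(\<integral>\<^sup>+ z. ennreal (dist (fst z) (snd z) powr p) \<partial>\<gamma>) \<le> ennreal (r powr p)"
  proof (rule LIMSEQ_le_const)
    have "(\<lambda>n. r powr p + 1 / real (Suc n)) \<longlonglongrightarrow> r powr p + 0"
      by (intro tendsto_intros LIMSEQ_Suc[OF lim_1_over_n])
    then show "(\<lambda>n. ennreal (s n)) \<longlonglongrightarrow> ennreal (r powr p)"
      unfolding s_def by (intro tendsto_ennrealI) simp
    show "\<exists>N. \<forall>n\<ge>N. (\<integral>\<^sup>+ z. ennreal (dist (fst z) (snd z) powr p) \<partial>\<gamma>) \<le> ennreal (s n)"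
      using \<gamma> by (auto simp: D_def plans_def)
  qed
  then show "\<exists>\<gamma>\<in>plans p (r powr p) \<nu>. distr \<gamma> borel fst = \<mu>"
    using \<gamma>[of 0] by (auto simp: D_def plans_def)
qed

theorem theorem1:
  fixes \<nu> :: "'a::polish_space measure" and p r :: real
  assumes proper: "\<forall>(x\<^sub>0::'a) R. R > 0 \<longrightarrow> compact (cball x\<^sub>0 R)"
    and "1 \<le> p"
    and "r > 0"
    and "\<nu> \<in> borel_probs"
    and "finite_moment p \<nu>"
  shows "compactin weak_topology (wasserstein_ball p r \<nu>)"
proof -
  have fst: "continuous_on UNIV (fst :: 'a \<times> 'a \<Rightarrow> 'a)"
    by (intro continuous_intros)
  have "compactin weak_topology ((\<lambda>\<gamma>. distr \<gamma> borel fst) ` plans p (r powr p) \<nu>)"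
    using assms by (intro image_compactin[OF compactin_plans continuous_map_distr] fst) auto
  also have "(\<lambda>\<gamma>. distr \<gamma> borel fst) ` plans p (r powr p) \<nu> = wasserstein_ball p r \<nu>"
  proof -
    have "distr \<gamma> borel fst \<in> borel_probs" if "\<gamma> \<in> plans p (r powr p) \<nu>" for \<gamma>
      using that distr_borel_probs[OF fst] by (simp add: plans_def)
    moreover have "wasserstein p \<mu> \<nu> \<le> ennreal r \<longleftrightarrow>
        (\<exists>\<gamma>\<in>plans p (r powr p) \<nu>. distr \<gamma> borel fst = \<mu>)" if "\<mu> \<in> borel_probs" for \<mu>
      using assms that by (intro wasserstein_le_iff_plan) auto
    ultimately show ?thesis
      unfolding wasserstein_ball_def by (auto simp: image_iff)
  qed
  finally show ?thesis .
qed

end
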